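(* Every flat numerical semigroup is representable.
   Context: A numerical semigroup is a submonoid of $\mathbb{N}=\{0,1,2,\dots\}$ with finite complement. Representable semigroups. For a normal weighted homogeneous surface singularity $(X,0)$ (germ at the origin of an affine surface with good effective $\mathbb{C}^*$-action, so that its coordinate ring is graded, $R_X=\bigoplus_{\ell\geq 0}R_{X,\ell}$) whose link is a rational homology sphere, put $\mathcal{S}_{(X,0)}=\{\ell\geq 0: R_{X,\ell}\neq 0\}$. A numerical semigroup is representable if it equals some such $\mathcal{S}_{(X,0)}$. By Pinkham this is equivalent to the following combinatorial description. An SSR graph $\Gamma$ is a negative definite star-shaped plumbing graph with all genera zero, determined by normalized Seifert invariants $Sf=(-b_0;(\alpha_i,\omega_i)_{i=1}^d)$, where $b_0\in\mathbb{Z}_{>0}$, $d\geq 3$, $0<\omega_i<\alpha_i$, $\gcd(\alpha_i,\omega_i)=1$, and $e:=-b_0+\sum_{i=1}^d\omega_i/\alpha_i<0$ (negative definiteness). Its quasi-linear function is $N(\ell)=b_0\ell-\sum_{i=1}^d\lceil \ell\omega_i/\alpha_i\rceil$, and $\mathcal{S}_\Gamma=\{\ell\in\mathbb{Z}: N(\ell)\geq 0\}$ (contained in $\mathbb{N}$). A numerical semigroup is representable iff it equals $\mathcal{S}_\Gamma$ for some SSR graph $\Gamma$. Flat semigroups. For $A=\{a_1,\dots,a_n\}$ with $\gcd(a_1,\dots,a_n)=1$, put $q_i:=\gcd(a_j: j\neq i)$, $\widehat{q}_i:=\prod_{j\neq i}q_j$ and $\widehat{s}_i:=a_i/\widehat{q}_i$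 (an integer, since the $q_i$ are pairwise relatively prime). $A$ is flat if $\widehat{s}_i=1$ for some $i$. A numerical semigroup is flat if its minimal set of generators is flat. The semigroup $\mathbb{N}$ is regarded as flat. *)

theory Defs
  imports Complex_Main "HOL.Hull"
begin

definition add_submonoid :: "nat set \<Rightarrow> bool" where
  "add_submonoid S \<longleftrightarrow> 0 \<in> S \<and> (\<forall>x\<in>S. \<forall>y\<in>S. x + y \<in> S)"

definition numerical_semigroup :: "nat set \<Rightarrow> bool" where
  "numerical_semigroup S \<longleftrightarrow> add_submonoid S \<and> finite (- S)"

text \<open>\<open>add_submonoid hull A\<close> is the smallest submonoid of the naturals containing \<open>A\<close>.\<close>

definition minimal_generating_set :: "nat set \<Rightarrow> nat set \<Rightarrow> bool" where
  "minimal_generating_set A S \<longleftrightarrow>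
     add_submonoid hull A = S \<and> (\<forall>B. B \<subset> A \<longrightarrow> add_submonoid hull B \<noteq> S)"

text \<open>
  The generators are pairwise distinct, so the numbers \<open>q\<^sub>i\<close>, \<open>q\<^sub>i\<close>-hat, \<open>s\<^sub>i\<close>-hat are indexed
  by the elements \<open>a\<^sub>i\<close> of the set themselves.
\<close>

definition flat_q :: "nat set \<Rightarrow> nat \<Rightarrow> nat" where
  "flat_q A a = Gcd (A - {a})"

definition flat_q_hat :: "nat set \<Rightarrow> nat \<Rightarrow> nat" where
  "flat_q_hat A a = (\<Prod>b\<in>A - {a}. flat_q A b)"

text \<open>
  The division is exact when \<open>A\<close> is finite with \<open>Gcd A = 1\<close>: the \<open>flat_q A b\<close> with \<open>b \<noteq> a\<close>
  are pairwise coprime divisors of \<open>a\<close>.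
\<close>

definition flat_s_hat :: "nat set \<Rightarrow> nat \<Rightarrow> nat" where
  "flat_s_hat A a = a div flat_q_hat A a"

definition flat_set :: "nat set \<Rightarrow> bool" where
  "flat_set A \<longleftrightarrow> finite A \<and> Gcd A = 1 \<and> (\<exists>a\<in>A. flat_s_hat A a = 1)"

text \<open>
  The minimal generating set is unique (lemma \<open>minimal_generating_set_unique\<close> below), so the
  existential quantifier just names it. For a numerical semigroup it is finite with greatest
  common divisor 1.
\<close>

definition flat_semigroup :: "nat set \<Rightarrow> bool" where
  "flat_semigroup S \<longleftrightarrow> S = UNIV \<or> (\<exists>A. minimal_generating_set A S \<and> flat_set A)"

text \<open>
  A star-shaped plumbing graph with all genera zero is encoded by its normalized Seifert
  invariants: \<open>b0\<close> and the list of the pairs \<open>(\<alpha>\<^sub>i, \<omega>\<^sub>i)\<close>, one for each leg; repeated pairs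
  are allowed. Negative definiteness of the graph is \<open>orbifold_euler b0 legs < 0\<close>.
\<close>

type_synonym seifert_legs = "(int \<times> int) list"

definition orbifold_euler :: "int \<Rightarrow> seifert_legs \<Rightarrow> rat" where
  "orbifold_euler b0 legs = - of_int b0 + (\<Sum>(\<alpha>, \<omega>)\<leftarrow>legs. of_int \<omega> / of_int \<alpha>)"

definition SSR_graph :: "int \<Rightarrow> seifert_legs \<Rightarrow> bool" where
  "SSR_graph b0 legs \<longleftrightarrow>
     b0 > 0 \<and> length legs \<ge> 3 \<and>
     (\<forall>(\<alpha>, \<omega>)\<in>set legs. 0 < \<omega> \<and> \<omega> < \<alpha> \<and> coprime \<alpha> \<omega>) \<and>
     orbifold_euler b0 legs < 0"

definition quasi_linear :: "int \<Rightarrow> seifert_legs \<Rightarrow> int \<Rightarrow> int" where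
  "quasi_linear b0 legs l =
     b0 * l - (\<Sum>(\<alpha>, \<omega>)\<leftarrow>legs. \<lceil>of_int (l * \<omega>) / (of_int \<alpha> :: rat)\<rceil>)"

definition graph_semigroup :: "int \<Rightarrow> seifert_legs \<Rightarrow> int set" where
  "graph_semigroup b0 legs = {l. quasi_linear b0 legs l \<ge> 0}"

text \<open>
  Representability is geometrically defined as being the set of degrees of the nonzero
  homogeneous parts of the coordinate ring of a normal weighted homogeneous surface singularity
  with rational homology sphere link. By a theorem of Pinkham it is equivalent to the following
  combinatorial condition, which is used as the definition.
\<close>

definition representable :: "nat set \<Rightarrow> bool" where
  "representable S \<longleftrightarrow> (\<exists>b0 legs. SSR_graph b0 legs \<and> int ` S = graph_semigroup b0 legs)"

lemma add_submonoid_hull: "add_submonoid (add_submonoid hull A)"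
  unfolding hull_def add_submonoid_def by blast

definition irreducibles :: "nat set \<Rightarrow> nat set" where
  "irreducibles S = {x\<in>S. x \<noteq> 0 \<and> (\<forall>y\<in>S. \<forall>z\<in>S. x = y + z \<longrightarrow> y = 0 \<or> z = 0)}"

lemma irreducibles_subset_generators:
  assumes "add_submonoid hull A = S"
  shows "irreducibles S \<subseteq> A"
proof
  fix x assume x: "x \<in> irreducibles S"
  show "x \<in> A"
  proof (rule ccontr)
    assume "x \<notin> A"
    have S: "add_submonoid S" using add_submonoid_hull[of A] unfolding assms .
    have x0: "x \<in> S" "x \<noteq> 0" using x unfolding irreducibles_def by blast+
    have "add_submonoid (S - {x})"
      unfolding add_submonoid_def
    proof (intro conjI ballI)
      show "0 \<in> S - {x}" using S x0 by (simp add: add_submonoid_def)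
      fix y z assume yz: "y \<in> S - {x}" "z \<in> S - {x}"
      then have "y + z \<in> S" using S unfolding add_submonoid_def by blast
      moreover have "y + z \<noteq> x"
      proof
        assume "y + z = x"
        then have "y = 0 \<or> z = 0" using x yz unfolding irreducibles_def by blast
        then show False using yz \<open>y + z = x\<close> by (elim disjE) simp_all
      qed
      ultimately show "y + z \<in> S - {x}" by simp
    qed
    moreover have "A \<subseteq> S - {x}"
      using \<open>x \<notin> A\<close> hull_subset[of A add_submonoid] unfolding assms by blast
    ultimately have "add_submonoid hull A \<subseteq> S - {x}"
      by (simp add: hull_minimal)
    then show False using x0 unfolding assms by blast
  qed
qed

lemma irreducibles_generate:
  assumes "add_submonoid S"
  shows "add_submonoid hull (irreducibles S) = S"
proof
  show "add_submonoid hull (irreducibles S) \<subseteq> S"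
    using assms by (intro hull_minimal[where S = add_submonoid]) (auto simp: irreducibles_def)
  have "x \<in> add_submonoid hull (irreducibles S)" if "x \<in> S" for x
    using that
  proof (induction x rule: less_induct)
    case (less x)
    let ?H = "add_submonoid hull (irreducibles S)"
    have H: "0 \<in> ?H" "\<And>u v. u \<in> ?H \<Longrightarrow> v \<in> ?H \<Longrightarrow> u + v \<in> ?H"
      using add_submonoid_hull[of "irreducibles S", unfolded add_submonoid_def[of ?H]] by blast+
    consider "x = 0" | "x \<in> irreducibles S"
      | y z where "y \<in> S" "z \<in> S" "x = y + z" "y \<noteq> 0" "z \<noteq> 0"
      using less.prems unfolding irreducibles_def by blast
    then show ?case
    proof cases
      case 1
      then show ?thesis using H(1) by simp
    next
      case 2
      then show ?thesis by (rule hull_inc)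
    next
      case 3
      then have "y \<in> ?H" "z \<in> ?H"
        using less.IH by auto
      then show ?thesis using H(2) 3(3) by simp
    qed
  qed
  then show "S \<subseteq> add_submonoid hull (irreducibles S)" by blast
qed

lemma minimal_generating_set_unique:
  assumes "add_submonoid S"
  shows "minimal_generating_set A S \<longleftrightarrow> A = irreducibles S"
proof
  assume A: "minimal_generating_set A S"
  then have "irreducibles S \<subseteq> A"
    unfolding minimal_generating_set_def by (elim conjE) (rule irreducibles_subset_generators)
  moreover have "\<not> irreducibles S \<subset> A"
    using A irreducibles_generate[OF assms] unfolding minimal_generating_set_def by metis
  ultimately show "A = irreducibles S" by (simp add: psubset_eq)
next
  assume A: "A = irreducibles S"
  have "add_submonoid hull B \<noteq> S" if "B \<subset> A" for B
    using irreducibles_subset_generators[of B S] that A by auto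
  then show "minimal_generating_set A S"
    using irreducibles_generate[OF assms] A unfolding minimal_generating_set_def by simp
qed

end

theory Submission
  imports Defs "HOL-Number_Theory.Cong"
begin

text \<open>
  Let \<open>a\<close> be the generator with trivial \<open>s\<close>-hat and write \<open>q\<^sub>b\<close> for the gcd of the generators
  other than \<open>b\<close>, so that \<open>a\<close> is the product of the \<open>q\<^sub>b\<close> with \<open>b \<noteq> a\<close>. Take \<open>m\<^sub>b = q\<^sub>b b / a\<close>
  legs \<open>(q\<^sub>b, \<omega>\<^sub>b)\<close> for each \<open>b \<noteq> a\<close>, where \<open>b \<omega>\<^sub>b \<equiv> -1\<close> modulo \<open>q\<^sub>b\<close>, and choose the central
  weight so that \<open>e = -1/a\<close>. Then \<open>l = a N(l) + (\<Sum>b. b k\<^sub>b(l))\<close>, where \<open>0 \<le> k\<^sub>b(l) < q\<^sub>b\<close> is the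
  residue of \<open>-l \<omega>\<^sub>b\<close> modulo \<open>q\<^sub>b\<close>; so \<open>N(l) \<ge> 0\<close> puts \<open>l\<close> into the semigroup. Conversely \<open>N\<close> is
  superadditive and non-negative on the generators.
  By minimality of the generating set \<open>m\<^sub>b \<ge> 2\<close>, hence there are at least three legs except
  when the generators are \<open>a\<close> and \<open>2\<close>, and then \<open>2\<close> can play the role of \<open>a\<close>.
\<close>

section \<open>Legs with multiplicities and closure of submonoids\<close>

definition leg_list :: "nat set \<Rightarrow> (nat \<Rightarrow> nat) \<Rightarrow> (nat \<Rightarrow> int \<times> int) \<Rightarrow> seifert_legs" where
  "leg_list B m p = concat (map (\<lambda>b. replicate (m b) (p b)) (sorted_list_of_set B))"

lemma set_leg_list_subset: "finite B \<Longrightarrow> set (leg_list B m p) \<subseteq> p ` B"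
  by (auto simp: leg_list_def)

lemma sum_list_leg_list:
  fixes f :: "int \<times> int \<Rightarrow> 'a :: comm_semiring_1"
  assumes "finite B"
  shows "(\<Sum>x\<leftarrow>leg_list B m p. f x) = (\<Sum>b\<in>B. of_nat (m b) * f (p b))"
proof -
  have "(\<Sum>x\<leftarrow>concat (map (\<lambda>b. replicate (m b) (p b)) bs). f x)
      = (\<Sum>b\<leftarrow>bs. of_nat (m b) * f (p b))" for bs
    by (induction bs) (simp_all add: sum_list_replicate)
  then show ?thesis
    using assms by (simp add: leg_list_def sum_list_distinct_conv_sum_set)
qed

lemma length_leg_list:
  assumes "finite B"
  shows "length (leg_list B m p) = (\<Sum>b\<in>B. m b)"
  using sum_list_leg_list[OF assms, of "\<lambda>_. 1 :: nat" m p] by (simp add: sum_list_triv)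

lemma add_submonoid_sum:
  assumes "add_submonoid S" and "\<And>b. b \<in> B \<Longrightarrow> f b \<in> S"
  shows "sum f B \<in> S"
  using assms by (induction B rule: infinite_finite_induct) (auto simp: add_submonoid_def)

lemma add_submonoid_mult:
  assumes "add_submonoid S" and "x \<in> S"
  shows "k * x \<in> S"
  using assms by (induction k) (auto simp: add_submonoid_def)

section \<open>Ceilings and the quasi-linear function\<close>

lemma quasi_linear_superadditive:
  "quasi_linear b0 legs x + quasi_linear b0 legs y \<le> quasi_linear b0 legs (x + y)"
proof -
  have "(\<Sum>(\<alpha>, \<omega>)\<leftarrow>legs. \<lceil>of_int ((x + y) * \<omega>) / (of_int \<alpha> :: rat)\<rceil>)
     \<le> (\<Sum>(\<alpha>, \<omega>)\<leftarrow>legs. \<lceil>of_int (x * \<omega>) / (of_int \<alpha> :: rat)\<rceil> + \<lceil>of_int (y * \<omega>) / (of_int \<alpha> :: rat)\<rceil>)"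
  proof (rule sum_list_mono, clarify)
    fix \<alpha> \<omega> :: int
    show "\<lceil>of_int ((x + y) * \<omega>) / (of_int \<alpha> :: rat)\<rceil>
      \<le> \<lceil>of_int (x * \<omega>) / (of_int \<alpha> :: rat)\<rceil> + \<lceil>of_int (y * \<omega>) / (of_int \<alpha> :: rat)\<rceil>"
      using ceiling_add_le[of "of_int (x * \<omega>) / (of_int \<alpha> :: rat)" "of_int (y * \<omega>) / (of_int \<alpha> :: rat)"]
      by (simp add: algebra_simps add_divide_distrib)
  qed
  also have "\<dots> = (\<Sum>(\<alpha>, \<omega>)\<leftarrow>legs. \<lceil>of_int (x * \<omega>) / (of_int \<alpha> :: rat)\<rceil>)
     + (\<Sum>(\<alpha>, \<omega>)\<leftarrow>legs. \<lceil>of_int (y * \<omega>) / (of_int \<alpha> :: rat)\<rceil>)"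
    by (simp add: case_prod_unfold sum_list_addf)
  finally show ?thesis
    by (simp add: quasi_linear_def algebra_simps)
qed

text \<open>Rounding \<open>x / q\<close> up is minus rounding \<open>- x / q\<close> down, so the
  excess is the remainder of \<open>- x\<close>.\<close>

lemma mult_ceiling_divide:
  fixes x q :: int
  assumes "q > 0"
  shows "q * \<lceil>of_int x / (of_int q :: rat)\<rceil> = x + (- x) mod q"
proof -
  have "\<lceil>of_int x / (of_int q :: rat)\<rceil> = - (- x div q)"
    unfolding ceiling_def by (metis floor_divide_of_int_eq minus_divide_left of_int_minus)
  then show ?thesis
    using mult_div_mod_eq[of q "- x"] by (metis add.commute add_diff_cancel_left' diff_minus_eq_add
        minus_mult_right minus_minus add_uminus_conv_diff)
qed

section \<open>From Seifert data to a representable semigroup\<close>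

text \<open>\<open>m\<close> and \<open>b0\<close> make the Euler number -1/a and tie
  \<open>N l\<close> to the residues \<open>k l b\<close>. \<open>inv\<close> and \<open>dvd\<close>
  fix these residues on the generators: \<open>k\<close> is 1 for a generator in \<open>B\<close> at
  its own legs and 0 at all others.\<close>

lemma representable_of_seifert_data:
  fixes a :: nat and b0 :: int and m :: "nat \<Rightarrow> nat" and q w :: "nat \<Rightarrow> int"
  assumes fin: "finite B" and a: "a > 0" "a \<notin> B"
    and q: "\<And>b. b \<in> B \<Longrightarrow> q b > 1"
    and w: "\<And>b. b \<in> B \<Longrightarrow> 0 < w b" "\<And>b. b \<in> B \<Longrightarrow> w b < q b"
    and inv: "\<And>b. b \<in> B \<Longrightarrow> q b dvd 1 + int b * w b"
    and dvd: "\<And>b c. b \<in> B \<Longrightarrow> c \<in> insert a B \<Longrightarrow> c \<noteq> b \<Longrightarrow> q b dvd int c"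
    and m: "\<And>b. b \<in> B \<Longrightarrow> int (m b) * int a = q b * int b"
    and b0: "int a * b0 = 1 + (\<Sum>b\<in>B. int b * w b)"
    and three: "(\<Sum>b\<in>B. m b) \<ge> 3"
  shows "representable (add_submonoid hull insert a B)"
proof -
  let ?S = "add_submonoid hull insert a B"
  define legs where "legs = leg_list B m (\<lambda>b. (q b, w b))"
  define N where "N = quasi_linear b0 legs"
  define k where "k l b = (- (l * w b)) mod q b" for l b
  have S: "add_submonoid ?S"
    by (rule add_submonoid_hull)
  \<comment> \<open>By \<open>m\<close>, multiplying by \<open>a\<close> turns the block of legs of
    \<open>b\<close> into \<open>b\<close> times \<open>q b\<close> times a ceiling, that is
    \<open>b\<close> times \<open>l * w b + k l b\<close>. The terms \<open>l * b * w b\<close> then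
    cancel against \<open>b0\<close>, which leaves \<open>l\<close>.\<close>
  have N_eq: "int a * N l = l - (\<Sum>b\<in>B. int b * k l b)" for l
  proof -
    have "int a * (int (m b) * \<lceil>of_int (l * w b) / (of_int (q b) :: rat)\<rceil>) = int b * (l * w b + k l b)"
      if "b \<in> B" for b
    proof -
      have "int a * (int (m b) * \<lceil>of_int (l * w b) / (of_int (q b) :: rat)\<rceil>)
          = int b * (q b * \<lceil>of_int (l * w b) / (of_int (q b) :: rat)\<rceil>)"
        using m[OF that] by (metis mult.assoc mult.commute)
      also have "\<dots> = int b * (l * w b + k l b)"
        using mult_ceiling_divide[of "q b" "l * w b"] q[OF that] by (simp add: k_def)
      finally show ?thesis .
    qed
    then have "int a * N l = int a * b0 * l - (\<Sum>b\<in>B. int b * (l * w b + k l b))"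
      using fin by (simp add: N_def quasi_linear_def legs_def sum_list_leg_list right_diff_distrib
          sum_distrib_left)
    also have "\<dots> = l - (\<Sum>b\<in>B. int b * k l b)"
      unfolding b0 by (simp add: algebra_simps sum.distrib sum_distrib_left)
    finally show ?thesis .
  qed
  have k_nonneg: "k l b \<ge> 0" if "b \<in> B" for l b
    using q[OF that] by (simp add: k_def)
  have k_zero: "k (int c) b = 0" if "b \<in> B" "c \<in> insert a B" "c \<noteq> b" for b c
    using dvd[OF that] by (simp add: k_def)
  have k_one: "k (int b) b = 1" if "b \<in> B" for b
  proof -
    have "(- (int b * w b)) mod q b = 1 mod q b"
      using inv[OF that] by (simp add: mod_eq_dvd_iff dvd_diff_commute)
    then show ?thesis
      using q[OF that] by (simp add: k_def)
  qed
  \<comment> \<open>In fact \<open>N\<close> is 1 at \<open>a\<close>, where all residues vanish,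
    and 0 at each \<open>c\<close> in \<open>B\<close>, where only the residue of its own legs
    survives.\<close>
  have "N (int c) \<ge> 0" if c: "c \<in> insert a B" for c
  proof (cases "c = a")
    case True
    have "(\<Sum>b\<in>B. int b * k (int a) b) = 0"
      using a k_zero by (intro sum.neutral) auto
    then show ?thesis
      using N_eq[of "int a"] a True by simp
  next
    case False
    then have "c \<in> B" using c by simp
    have "(\<Sum>b\<in>B. int b * k (int c) b) = (\<Sum>b\<in>B. if b = c then int c else 0)"
      using k_zero[OF _ c] k_one by (intro sum.cong) auto
    then show ?thesis
      using N_eq[of "int c"] a fin \<open>c \<in> B\<close> by simp
  qed
  moreover have "add_submonoid {n. N (int n) \<ge> 0}"
    unfolding add_submonoid_def
  proof (intro conjI ballI)
    show "0 \<in> {n. N (int n) \<ge> 0}"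
      by (simp add: N_def quasi_linear_def case_prod_unfold)
    show "x + y \<in> {n. N (int n) \<ge> 0}" if "x \<in> {n. N (int n) \<ge> 0}" "y \<in> {n. N (int n) \<ge> 0}" for x y
      using that quasi_linear_superadditive[of b0 legs "int x" "int y"] by (simp add: N_def)
  qed
  ultimately have "?S \<subseteq> {n. N (int n) \<ge> 0}"
    by (intro hull_minimal) auto
  then have sub: "int ` ?S \<subseteq> graph_semigroup b0 legs"
    by (auto simp: graph_semigroup_def N_def)
  \<comment> \<open>Here \<open>l\<close> is any integer; \<open>N_eq\<close> writes it as a
    combination of generators with nonnegative coefficients, which also excludes negative
    \<open>l\<close>.\<close>
  have "l \<in> int ` ?S" if "N l \<ge> 0" for l
  proof
    have "nat (N l) * a + (\<Sum>b\<in>B. nat (k l b) * b) \<in> ?S" (is "?n \<in> _")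
    proof -
      have "(\<Sum>b\<in>B. nat (k l b) * b) \<in> ?S" and "nat (N l) * a \<in> ?S"
        by (intro add_submonoid_sum[OF S] add_submonoid_mult[OF S] hull_inc; simp)+
      then show ?thesis
        using S by (simp add: add_submonoid_def)
    qed
    then show "?n \<in> ?S" .
    have "int ?n = int a * N l + (\<Sum>b\<in>B. int b * k l b)"
      using that k_nonneg by (simp add: mult.commute)
    then show "l = int ?n"
      using N_eq[of l] by simp
  qed
  then have "int ` ?S = graph_semigroup b0 legs"
    using sub by (auto simp: graph_semigroup_def N_def)
  moreover have "SSR_graph b0 legs"
    unfolding SSR_graph_def
  proof (intro conjI)
    have "int a * b0 > 0"
      unfolding b0 using w by (intro add_pos_nonneg sum_nonneg) (simp_all add: less_imp_le)
    then show "b0 > 0"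
      using a by (simp add: zero_less_mult_iff)
    show "length legs \<ge> 3"
      using three fin by (simp add: legs_def length_leg_list)
    have "coprime (q b) (w b)" if "b \<in> B" for b
    proof (rule coprimeI)
      fix d assume "d dvd q b" "d dvd w b"
      then have "d dvd 1 + int b * w b" "d dvd int b * w b"
        using inv[OF that] by (auto intro: dvd_trans)
      then show "is_unit d"
        by (metis dvd_add_left_iff)
    qed
    then show "\<forall>(\<alpha>, \<omega>)\<in>set legs. 0 < \<omega> \<and> \<omega> < \<alpha> \<and> coprime \<alpha> \<omega>"
      using set_leg_list_subset[OF fin, of m "\<lambda>b. (q b, w b)"] w by (auto simp: legs_def)
    have "of_nat a * (of_nat (m b) * (of_int (w b) / of_int (q b))) = (of_int (int b * w b) :: rat)"
      if "b \<in> B" for b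
    proof -
      have "of_nat (m b) * of_nat a = (of_int (q b) * of_nat b :: rat)"
        using arg_cong[OF m[OF that], of "of_int :: int \<Rightarrow> rat"] by simp
      then show ?thesis
        using q[OF that] by (simp add: field_simps)
    qed
    then have "of_nat a * orbifold_euler b0 legs = of_int (- (int a * b0) + (\<Sum>b\<in>B. int b * w b))"
      using fin by (simp add: orbifold_euler_def legs_def sum_list_leg_list ring_distribs sum_distrib_left)
    also have "\<dots> = -1"
      unfolding b0 by simp
    finally show "orbifold_euler b0 legs < 0"
      using a by (metis mult_nonneg_nonneg not_less of_nat_0_le_iff neg_0_le_iff_le not_one_le_zero)
  qed
  ultimately show ?thesis
    unfolding representable_def by blast
qed

section \<open>Arithmetic of the numbers \<open>flat_q\<close> and construction of the Seifert
  data\<close>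

lemma prod_dvd_of_pairwise_coprime:
  fixes f :: "'b \<Rightarrow> 'a :: semiring_gcd"
  assumes "\<And>i. i \<in> I \<Longrightarrow> f i dvd n"
    and "\<And>i j. i \<in> I \<Longrightarrow> j \<in> I \<Longrightarrow> i \<noteq> j \<Longrightarrow> coprime (f i) (f j)"
  shows "prod f I dvd n"
  using assms
proof (induction I rule: infinite_finite_induct)
  case (insert i I)
  have "coprime (f i) (prod f I)"
    using insert by (intro prod_coprime_right) auto
  then show ?case
    using insert by (auto intro: divides_mult)
qed simp_all

lemma flat_q_dvd: "c \<in> A \<Longrightarrow> c \<noteq> b \<Longrightarrow> flat_q A b dvd c"
  unfolding flat_q_def by (intro Gcd_dvd) auto

lemma coprime_flat_q:
  assumes "Gcd A = 1" and "b \<in> A"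
  shows "coprime b (flat_q A b)"
  using assms Gcd_insert[of b "A - {b}"]
  unfolding flat_q_def coprime_iff_gcd_eq_1 by (simp add: insert_absorb)

text \<open>The first number divides \<open>c\<close>, and \<open>c\<close> is coprime to the
  second.\<close>

lemma coprime_flat_q_flat_q:
  assumes "Gcd A = 1" and "b \<in> A" and "c \<in> A" and "b \<noteq> c"
  shows "coprime (flat_q A b) (flat_q A c)"
  using coprime_flat_q[OF assms(1,3)] flat_q_dvd[OF assms(3), of b] assms(4)
  by (metis coprime_divisors dvd_refl)

text \<open>The \<open>flat_q A c\<close> with \<open>c\<close> other than \<open>a\<close> and
  \<open>b\<close> are pairwise coprime divisors of \<open>b\<close>, so their product divides
  \<open>b\<close>; the missing factor \<open>flat_q A b\<close> completes it to \<open>a\<close>.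
  Hence the number of legs attached to \<open>b\<close> is an integer.\<close>

lemma dvd_flat_q_mult:
  assumes "finite A" and "Gcd A = 1" and "(\<Prod>b\<in>A - {a}. flat_q A b) = a" and b: "b \<in> A - {a}"
  shows "a dvd flat_q A b * b"
proof -
  have "prod (flat_q A) (A - {a} - {b}) dvd b"
    using coprime_flat_q_flat_q[OF assms(2)] flat_q_dvd[of b A] b
    by (intro prod_dvd_of_pairwise_coprime) auto
  then have "flat_q A b * prod (flat_q A) (A - {a} - {b}) dvd flat_q A b * b"
    by (rule mult_dvd_mono[OF dvd_refl])
  then show ?thesis
    using prod.remove[OF _ b, of "flat_q A"] assms(1,3) by (metis finite_Diff)
qed

lemma representable_of_flat_generator:
  assumes fin: "finite A" and gcd: "Gcd A = 1" and a: "a \<in> A" "a > 0"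
    and q: "\<And>b. b \<in> A - {a} \<Longrightarrow> flat_q A b > 1"
    and prod: "(\<Prod>b\<in>A - {a}. flat_q A b) = a"
    and three: "(\<Sum>b\<in>A - {a}. flat_q A b * b div a) \<ge> 3"
  shows "representable (add_submonoid hull A)"
proof -
  let ?B = "A - {a}"
  define q where "q b = int (flat_q A b)" for b
  have q1: "q b > 1" if "b \<in> ?B" for b
    using assms(5)[OF that] by (simp add: q_def)
  have q_dvd: "q b dvd int c" if "b \<in> ?B" "c \<in> A" "c \<noteq> b" for b c
    using flat_q_dvd[OF that(2,3)] by (simp add: q_def)
  have "\<exists>w. 0 < w \<and> w < q b \<and> q b dvd 1 + int b * w" if b: "b \<in> ?B" for b
  proof -
    have "coprime (int b) (q b)"
      using coprime_flat_q[OF gcd] b by (simp add: q_def)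
    then obtain x where x: "[int b * x = 1] (mod q b)"
      using cong_solve_coprime_int by blast
    define w where "w = (- x) mod q b"
    have "[int b * w = int b * (- x)] (mod q b)"
      unfolding w_def by (intro cong_scalar_left) simp
    also have "[int b * (- x) = - 1] (mod q b)"
      using x by (simp add: cong_minus_minus_iff)
    finally have dvd: "q b dvd 1 + int b * w"
      by (simp add: cong_iff_dvd_diff add.commute)
    \<comment> \<open>Otherwise \<open>q b\<close> would divide 1. Normalized Seifert invariants
      require a positive \<open>w\<close>.\<close>
    have "w \<noteq> 0"
      using dvd q1[OF b] by auto
    then show ?thesis
      using dvd q1[OF b] unfolding w_def
      by (metis order.strict_trans pos_mod_bound pos_mod_sign zero_less_one order_le_less)
  qed
  then obtain w where w: "\<And>b. b \<in> ?B \<Longrightarrow> 0 < w b" "\<And>b. b \<in> ?B \<Longrightarrow> w b < q b"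
      "\<And>b. b \<in> ?B \<Longrightarrow> q b dvd 1 + int b * w b"
    by metis
  have coprime_q: "coprime (q b) (q c)" if "b \<in> ?B" "c \<in> ?B" "b \<noteq> c" for b c
    using coprime_flat_q_flat_q[OF gcd] that by (simp add: q_def)
  have prod_q: "prod q ?B = int a"
    using arg_cong[OF prod, of int] by (simp add: q_def)
  \<comment> \<open>Modulo \<open>q b\<close> only the summand of \<open>b\<close> survives, and it
    is -1. As the \<open>q b\<close> are pairwise coprime with product \<open>a\<close>, the whole
    expression is divisible by \<open>a\<close>, and the quotient is the central weight.\<close>
  have "q b dvd 1 + (\<Sum>c\<in>?B. int c * w c)" if b: "b \<in> ?B" for b
  proof -
    have "q b dvd (\<Sum>c\<in>?B - {b}. int c * w c)"
      using q_dvd[OF b] by (intro dvd_sum) auto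
    then have "q b dvd (1 + int b * w b) + (\<Sum>c\<in>?B - {b}. int c * w c)"
      using w(3)[OF b] by (rule dvd_add[rotated])
    then show ?thesis
      using fin b by (simp add: sum.remove[of ?B b] add.assoc)
  qed
  then have "prod q ?B dvd 1 + (\<Sum>c\<in>?B. int c * w c)"
    by (rule prod_dvd_of_pairwise_coprime[OF _ coprime_q])
  then obtain b0 where b0: "int a * b0 = 1 + (\<Sum>c\<in>?B. int c * w c)"
    unfolding prod_q by (metis dvdE)
  have m: "int (flat_q A b * b div a) * int a = q b * int b" if b: "b \<in> ?B" for b
    using dvd_flat_q_mult[OF fin gcd prod b] by (simp add: q_def flip: of_nat_mult)
  have "representable (add_submonoid hull insert a ?B)"
    by (rule representable_of_seifert_data[OF finite_Diff[OF fin] a(2) _ q1 w q_dvd m b0 three])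
      (use a(1) in auto)
  then show ?thesis
    using a by (simp add: insert_absorb)
qed

section \<open>The trivial semigroup and the proof of the theorem\<close>

lemma representable_UNIV: "representable UNIV"
proof -
  \<comment> \<open>With the single generator 1 the general construction would give no legs. For
    this graph, \<open>N\<close> at \<open>l\<close> is three times \<open>l div 2\<close>, which is
    nonnegative exactly for nonnegative \<open>l\<close>.\<close>
  let ?legs = "[(2, 1), (2, 1), (2, 1)] :: seifert_legs"
  have "quasi_linear 3 ?legs l = 3 * (l div 2)" for l
    using mult_ceiling_divide[of 2 l] by (simp add: quasi_linear_def) presburger
  then have "graph_semigroup 3 ?legs = {0..}"
    by (auto simp: graph_semigroup_def)
  moreover have "int ` UNIV = {0..}"
    by (auto intro: image_eqI[of _ int "nat _"])
  moreover have "SSR_graph 3 ?legs"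
    by (simp add: SSR_graph_def orbifold_euler_def)
  ultimately show ?thesis
    unfolding representable_def by metis
qed

text \<open>A proper multiple \<open>y * k\<close> splits as \<open>y\<close> plus
  \<open>(k - 1) * y\<close>, both nonzero elements of \<open>S\<close>.\<close>

lemma irreducible_not_dvd:
  assumes S: "add_submonoid S" and xy: "x \<in> irreducibles S" "y \<in> irreducibles S" "x \<noteq> y"
  shows "\<not> y dvd x"
proof
  assume "y dvd x"
  then obtain k where k: "x = y * k" ..
  have "x \<noteq> 0" using xy(1) by (simp add: irreducibles_def)
  then have "k \<noteq> 0" "k \<noteq> 1" "y \<noteq> 0" using k xy(3) by auto
  then have "x = y + (k - 1) * y" "(k - 1) * y \<noteq> 0"
    using k by (simp_all add: algebra_simps)
  moreover have "(k - 1) * y \<in> S" "y \<in> S"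
    using xy(2) add_submonoid_mult[OF S] by (simp_all add: irreducibles_def)
  ultimately show False
    using xy(1) \<open>y \<noteq> 0\<close> unfolding irreducibles_def mem_Collect_eq by metis
qed

theorem theorem4p1p3:
  fixes S :: "nat set"
  assumes "numerical_semigroup S"
    and "flat_semigroup S"
  shows "representable S"
proof (cases "S = UNIV")
  case True
  then show ?thesis
    using representable_UNIV by simp
next
  case False
  then obtain A where A: "minimal_generating_set A S" and "flat_set A"
    using assms(2) by (auto simp: flat_semigroup_def)
  then obtain a where fin: "finite A" and gcd: "Gcd A = 1" and a: "a \<in> A" "flat_s_hat A a = 1"
    by (auto simp: flat_set_def)
  have S: "add_submonoid S"
    using assms(1) by (simp add: numerical_semigroup_def)
  have hull: "add_submonoid hull A = S" and irr: "A = irreducibles S"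
    using A minimal_generating_set_unique[OF S] by (auto simp: minimal_generating_set_def)
  have not_dvd: "\<not> b dvd c" if "b \<in> A" "c \<in> A" "b \<noteq> c" for b c
    using irreducible_not_dvd[OF S] that irr by blast
  have "1 \<notin> A"
  proof
    assume "1 \<in> A"
    then have "k * 1 \<in> S" for k
      using hull_inc[of 1 A add_submonoid] unfolding hull by (intro add_submonoid_mult[OF S])
    then show False
      using False by auto
  qed
  then have ge2: "b \<ge> 2" if "b \<in> A" for b
    using that irr by (metis (mono_tags, lifting) One_nat_def irreducibles_def less_2_cases
        mem_Collect_eq not_le)
  let ?B = "A - {a}"
  have "a > 0" using ge2[OF a(1)] by simp
  have "prod (flat_q A) ?B dvd a"
    using coprime_flat_q_flat_q[OF gcd] flat_q_dvd[OF a(1)]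
    by (intro prod_dvd_of_pairwise_coprime) auto
  then have prod: "prod (flat_q A) ?B = a"
    using a(2) by (metis dvd_div_mult_self flat_q_hat_def flat_s_hat_def mult_1)
  have q_dvd_a: "flat_q A b dvd a" if "b \<in> ?B" for b
    using flat_q_dvd[of a A b] a(1) that by auto
  \<comment> \<open>If \<open>flat_q A b\<close> were 1, then \<open>a\<close> would divide the
    other minimal generator \<open>b\<close>.\<close>
  have q: "flat_q A b > 1" if b: "b \<in> ?B" for b
  proof -
    have "flat_q A b \<noteq> 1"
    proof
      assume "flat_q A b = 1"
      then have "a dvd b"
        using dvd_flat_q_mult[OF fin gcd prod b] by simp
      then show False
        using not_dvd[of a b] a(1) b by auto
    qed
    moreover have "flat_q A b \<noteq> 0"
      using q_dvd_a[OF b] \<open>a > 0\<close> by auto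
    ultimately show ?thesis by simp
  qed
  show ?thesis
  proof (cases "(\<Sum>b\<in>?B. flat_q A b * b div a) \<ge> 3")
    case True
    then show ?thesis
      using representable_of_flat_generator[OF fin gcd a(1) \<open>a > 0\<close> q prod] hull by simp
  next
    case few: False
    \<comment> \<open>A quotient of 1 would make \<open>b\<close> a divisor of \<open>a\<close>.
      With at least two legs for each \<open>b\<close>, fewer than three in total leave at most one
      \<open>b\<close>.\<close>
    have "flat_q A b * b div a \<ge> 2" if b: "b \<in> ?B" for b
    proof -
      obtain k where k: "flat_q A b * b = a * k"
        using dvd_flat_q_mult[OF fin gcd prod b] ..
      have "k \<noteq> 0"
        using k q[OF b] ge2[of b] b by (metis DiffD1 mult_eq_0_iff not_numeral_le_zero not_one_less_zero)
      moreover have "k \<noteq> 1"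
        using k not_dvd[of b a] a(1) b by auto
      ultimately show ?thesis
        using k \<open>a > 0\<close> by simp
    qed
    then have "2 * card ?B < 3"
      using few sum_mono[of ?B "\<lambda>_. 2" "\<lambda>b. flat_q A b * b div a"] by simp
    \<comment> \<open>Over the empty set the product is 1, which would force \<open>a\<close> to be
      1.\<close>
    moreover have "?B \<noteq> {}"
      using prod \<open>1 \<notin> A\<close> a(1) by (metis prod.empty)
    then have "card ?B \<noteq> 0"
      using fin by simp
    ultimately have "card ?B = 1"
      by linarith
    then obtain b where b: "?B = {b}"
      by (metis card_1_singletonE)
    then have A_eq: "A = {a, b}" and "a \<noteq> b"
      using a(1) by auto
    \<comment> \<open>With a single factor, \<open>prod\<close> says that \<open>flat_q A b\<close>
      is \<open>a\<close>, so the number of legs is \<open>b\<close> itself, which is less than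
      3.\<close>
    have "b = 2"
      using few ge2[of b] \<open>a > 0\<close> prod unfolding b by (simp add: A_eq)
    have "a \<ge> 3"
      using ge2[OF a(1)] \<open>a \<noteq> b\<close> \<open>b = 2\<close> by simp
    have "A - {2} = {a}"
      using A_eq \<open>a \<noteq> b\<close> \<open>b = 2\<close> by auto
    moreover have "flat_q A a = 2"
      using b \<open>b = 2\<close> by (simp add: flat_q_def)
    \<comment> \<open>With 2 as the distinguished generator, \<open>flat_q A a\<close> is 2 and the
      number of legs becomes \<open>2 * a div 2\<close>, that is \<open>a\<close>, which is at least
      3.\<close>
    ultimately have "representable (add_submonoid hull A)"
      using fin gcd A_eq \<open>b = 2\<close> \<open>a \<ge> 3\<close>
      by (intro representable_of_flat_generator[where a = 2]) auto
    then show ?thesis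
      using hull by simp
  qed
qed

end
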